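(* Let $u$ be a positive integer (regarded as a one-letter word). Then a finite word $w$ over the positive integers satisfies $uw\equiv wu$ if and only if the tableau $P=P(w)$, with rows $R_1,R_2,\ldots$ (rows beyond the last nonempty one taken to be empty), satisfies (a) every entry of $R_1$ is at most $u$, and (b) for every $i\ge1$, $\#R_i(<u)=\#R_{i+1}(\le u)$.
   Context: $P(v)$ is the RSK insertion tableau of the word $v$ (row $R_1$ on top). $\equiv$ is Knuth equivalence: $v\equiv w$ iff $P(v)=P(w)$. For a row $R$ and a condition $I$ on integers, $R(I)$ is the multiset of entries of $R$ satisfying $I$; e.g. $\#R(<u)$ is the number of entries of $R$ that are less than $u$ and $\#R(\le u)$ the number that are at most $u$. *)

theory Defs
  imports Main "HOL-Library.Multiset"
begin

text \<open>
  Words are lists of natural numbers; a tableau is the list of its nonempty rows, top row first,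
  each row read from left to right.
\<close>

text \<open>
  Schensted row insertion of a letter into a weakly increasing row: the leftmost entry strictly
  greater than the letter is replaced by it and bumped out; if there is no such entry, the letter
  is appended at the end and nothing is bumped.
\<close>
fun row_insert :: "nat \<Rightarrow> nat list \<Rightarrow> nat list \<times> nat option" where
  "row_insert x [] = ([x], None)"
| "row_insert x (y # ys) =
     (if x < y then (x # ys, Some y)
      else (case row_insert x ys of (R, b) \<Rightarrow> (y # R, b)))"

fun tableau_insert :: "nat \<Rightarrow> nat list list \<Rightarrow> nat list list" where
  "tableau_insert x [] = [[x]]"
| "tableau_insert x (R # T) =
     (case row_insert x R of
        (R', None) \<Rightarrow> R' # T
      | (R', Some y) \<Rightarrow> R' # tableau_insert y T)"

text \<open>The letters of the word are inserted from left to right.\<close>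
definition P_tableau :: "nat list \<Rightarrow> nat list list" where
  "P_tableau v = fold tableau_insert v []"

definition knuth_equiv :: "nat list \<Rightarrow> nat list \<Rightarrow> bool" (infix "\<equiv>\<^sub>K" 50) where
  "v \<equiv>\<^sub>K w \<longleftrightarrow> P_tableau v = P_tableau w"

text \<open>Rows are numbered from 1, as in \<open>R\<^sub>1, R\<^sub>2, \<dots>\<close>; the value at index 0 is irrelevant.\<close>
definition tableau_row :: "nat list list \<Rightarrow> nat \<Rightarrow> nat list" where
  "tableau_row T i = (if 1 \<le> i \<and> i \<le> length T then T ! (i - 1) else [])"

text \<open>The multiset \<open>R(I)\<close> of entries of a row satisfying a condition.\<close>
definition row_part :: "nat list \<Rightarrow> (nat \<Rightarrow> bool) \<Rightarrow> nat multiset" where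
  "row_part R I = filter_mset I (mset R)"

end

theory Submission
  imports Defs
begin

text \<open>
  Insert \<open>w\<close> into the empty tableau and, in parallel, into the tableau with the single entry \<open>u\<close>.
  The first row of the latter has one surplus entry \<open>e\<close> compared with that of the former, until the
  surplus is bumped for good; it starts as \<open>e = u\<close> and never decreases. If it is still \<open>u\<close> at the
  end, then the lower rows of \<open>P(uw)\<close> and \<open>P(w)\<close> agree, so \<open>P(uw) = P(wu)\<close> iff \<open>u\<close> is appended to
  \<open>R\<^sub>1\<close>, which is (a). Otherwise \<open>P(uw)\<close> and \<open>P(wu)\<close> already differ in the first row. The surplus
  stays \<open>u\<close> iff every letter less than \<open>u\<close> bumps an entry at most \<open>u\<close> from the first row, that is,
  iff \<open>#R\<^sub>1(\<le>u)\<close> is the number of letters \<open>u\<close> in \<open>w\<close>. As columns increase strictly,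
  \<open>#R\<^sub>i(<u) \<ge> #R\<^bsub>i+1\<^esub>(\<le>u)\<close>, and summing over \<open>i\<close> shows that \<open>#R\<^sub>1(\<le>u)\<close> exceeds that number by
  the total of these differences; so equality is (b).
\<close>

section \<open>Row insertion into sorted rows\<close>

text \<open>\<open>M\<close> collects the entries that stay. Later arguments thus compare rows as
  multisets and ignore positions, which loses nothing because a sorted row is determined by its
  multiset.\<close>

lemma row_insert_cases:
  assumes "sorted R"
  obtains (append) "row_insert x R = (R @ [x], None)" "\<forall>z\<in>set R. z \<le> x"
  | (bump) R' y M where "row_insert x R = (R', Some y)" "sorted R'" "x < y"
      "mset R = add_mset y M" "mset R' = add_mset x M" "\<forall>z\<in>set R. x < z \<longrightarrow> y \<le> z"
proof -
  have "(row_insert x R = (R @ [x], None) \<and> (\<forall>z\<in>set R. z \<le> x)) \<or>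
    (\<exists>R' y M. row_insert x R = (R', Some y) \<and> sorted R' \<and> x < y \<and>
      mset R = add_mset y M \<and> mset R' = add_mset x M \<and> (\<forall>z\<in>set R. x < z \<longrightarrow> y \<le> z))"
    using assms
  proof (induction R)
    case Nil
    then show ?case by simp
  next
    case (Cons a R)
    show ?case
    proof (cases "x < a")
      case True
      then show ?thesis using Cons.prems by (auto intro: order.trans)
    next
      case False
      have "sorted R" using Cons.prems by simp
      from Cons.IH[OF this] show ?thesis
      proof (elim disjE exE conjE)
        assume "row_insert x R = (R @ [x], None)" "\<forall>z\<in>set R. z \<le> x"
        then show ?thesis using False by auto
      next
        fix R' y M
        assume *: "row_insert x R = (R', Some y)" "sorted R'" "x < y"
          "mset R = add_mset y M" "mset R' = add_mset x M" "\<forall>z\<in>set R. x < z \<longrightarrow> y \<le> z"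
        have "set R' \<subseteq> insert x (set R)"
          using *(4,5) by (metis set_mset_mset set_mset_add_mset_insert insert_mono subset_insertI)
        then have "sorted (a # R')"
          using *(2) Cons.prems False by auto
        moreover have "mset (a # R) = add_mset y (add_mset a M)"
          "mset (a # R') = add_mset x (add_mset a M)"
          using *(4,5) by simp_all
        moreover have "row_insert x (a # R) = (a # R', Some y)"
          using False *(1) by simp
        ultimately show ?thesis
          using *(3,6) False by auto
      qed
    qed
  qed
  then show thesis using that by blast
qed

lemma tableau_row_Nil [simp]: "tableau_row [] i = []"
  by (auto simp: tableau_row_def)

lemma tableau_row_Cons_1 [simp]: "tableau_row (R # T) (Suc 0) = R"
  by (simp add: tableau_row_def)

lemma tableau_row_Cons_Suc [simp]: "tableau_row (R # T) (Suc (Suc i)) = tableau_row T (Suc i)"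
  by (simp add: tableau_row_def)

lemma tableau_insert_ne_Nil [simp]: "tableau_insert x T \<noteq> []"
  by (cases T) (auto split: prod.split option.split)

lemma tableau_insert_row_1:
  "tableau_row (tableau_insert x T) (Suc 0) = fst (row_insert x (tableau_row T (Suc 0)))"
  by (cases T) (auto split: prod.split option.split)

lemma tl_tableau_insert:
  "tl (tableau_insert x T) = (case snd (row_insert x (tableau_row T (Suc 0))) of
     None \<Rightarrow> tl T | Some y \<Rightarrow> tableau_insert y (tl T))"
  by (cases T) (auto split: prod.split option.split)

lemma tableau_eqI:
  assumes "S \<noteq> []" "T \<noteq> []" "tableau_row S (Suc 0) = tableau_row T (Suc 0)" "tl S = tl T"
  shows "S = T"
  using assms by (cases S; cases T) auto

lemma P_tableau_snoc: "P_tableau (w @ [x]) = tableau_insert x (P_tableau w)"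
  by (simp add: P_tableau_def)

section \<open>Counting entries and strict columns\<close>

abbreviation count_le :: "nat \<Rightarrow> nat multiset \<Rightarrow> nat" where
  "count_le v M \<equiv> size (filter_mset (\<lambda>x. x \<le> v) M)"

abbreviation count_less :: "nat \<Rightarrow> nat multiset \<Rightarrow> nat" where
  "count_less v M \<equiv> size (filter_mset (\<lambda>x. x < v) M)"

lemma count_le_eq: "count_le v M = count_less v M + count M v"
  by (induction M) auto

lemma count_less_mono: "v \<le> v' \<Longrightarrow> count_less v M \<le> count_less v' M"
  by (induction M) auto

text \<open>For increasing rows this says that \<open>R\<close> above \<open>S\<close> has strictly increasing columns.\<close>
definition strictly_above :: "nat list \<Rightarrow> nat list \<Rightarrow> bool" where
  "strictly_above R S \<longleftrightarrow> (\<forall>v. count_le v (mset S) \<le> count_less v (mset R))"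

text \<open>The critical thresholds \<open>v\<close> lie above \<open>y\<close> and below the entry
  that \<open>y\<close> bumps, if any: there the count in \<open>S\<close> grows, but trading
  \<open>y\<close> for \<open>x\<close> does not help the row above. Since \<open>S\<close> has no
  entry above \<open>y\<close> up to \<open>v\<close>, its count at \<open>v\<close> is that at
  \<open>y\<close>, where the entry \<open>y\<close> of \<open>R\<close> is not counted yet; this
  entry is the slack.\<close>

lemma strictly_above_bump:
  assumes "strictly_above R S" "sorted S" "x < y"
    and R: "mset R = add_mset y M" "mset R' = add_mset x M"
  shows "strictly_above R' (fst (row_insert y S))"
  unfolding strictly_above_def
proof
  fix v
  have above: "count_le v' (mset S) \<le> count_less v' (mset R)" for v'
    using assms(1) by (simp add: strictly_above_def)
  have M: "count_le v' (mset S) \<le> count_less v' M + (if y < v' then 1 else 0)" for v'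
    using above[of v'] R(1) by (simp split: if_splits)
  from assms(2) show "count_le v (mset (fst (row_insert y S))) \<le> count_less v (mset R')"
  proof (cases rule: row_insert_cases[of S y])
    case append
    show ?thesis
    proof (cases "y < v")
      case True
      have "count_le v (mset S) = count_le y (mset S)"
        using append(2) True by (intro arg_cong[of _ _ size] filter_mset_cong) auto
      also have "\<dots> \<le> count_less y M" using M[of y] by simp
      also have "\<dots> \<le> count_less v M" using True by (simp add: count_less_mono)
      finally show ?thesis using append True \<open>x < y\<close> R by simp
    next
      case False
      then show ?thesis using append M[of v] \<open>x < y\<close> R by auto
    qed
  next
    case (bump S' z N)
    show ?thesis
    proof (cases "y < v \<and> v < z")
      case True
      have "count_le v (mset S) = count_le y (mset S)"
        using bump(6) True
        by (intro arg_cong[of _ _ size] filter_mset_cong) (auto simp: not_le[symmetric])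
      also have "\<dots> \<le> count_less y M" using M[of y] by simp
      also have "\<dots> \<le> count_less v M" using True by (simp add: count_less_mono)
      finally show ?thesis using bump True \<open>x < y\<close> R by simp
    next
      case False
      then show ?thesis using bump M[of v] \<open>x < y\<close> R by (auto split: if_splits)
    qed
  qed
qed

fun is_tableau :: "nat list list \<Rightarrow> bool" where
  "is_tableau [] \<longleftrightarrow> True"
| "is_tableau (R # T) \<longleftrightarrow> sorted R \<and> strictly_above R (tableau_row T 1) \<and> is_tableau T"

lemma is_tableau_sorted_row_1: "is_tableau T \<Longrightarrow> sorted (tableau_row T (Suc 0))"
  by (cases T) auto

lemma is_tableau_insert: "is_tableau T \<Longrightarrow> is_tableau (tableau_insert x T)"
proof (induction T arbitrary: x)
  case Nil
  then show ?case by (simp add: strictly_above_def)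
next
  case (Cons R T)
  have "sorted R" using Cons.prems by simp
  then show ?case
  proof (cases rule: row_insert_cases[of R x])
    case append
    have "strictly_above (R @ [x]) (tableau_row T (Suc 0))"
      using Cons.prems by (auto simp: strictly_above_def intro: le_SucI)
    then show ?thesis using append Cons.prems by (auto simp: sorted_append)
  next
    case (bump R' y M)
    then have "strictly_above R' (tableau_row (tableau_insert y T) (Suc 0))"
      using strictly_above_bump[of R "tableau_row T (Suc 0)" x y M R'] Cons.prems
      by (simp add: tableau_insert_row_1 is_tableau_sorted_row_1)
    then show ?thesis using bump Cons by auto
  qed
qed

section \<open>Content of the tableau and the first row\<close>

lemma mset_concat_tableau_insert:
  "is_tableau T \<Longrightarrow> mset (concat (tableau_insert x T)) = add_mset x (mset (concat T))"
proof (induction T arbitrary: x)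
  case Nil
  then show ?case by simp
next
  case (Cons R T)
  have "sorted R" using Cons.prems by simp
  then show ?case
    by (cases rule: row_insert_cases[of R x]) (use Cons in auto)
qed

lemma is_tableau_P: "is_tableau (P_tableau w)"
  by (induction w rule: rev_induct) (simp_all add: P_tableau_def is_tableau_insert)

lemma mset_P_tableau: "mset (concat (P_tableau w)) = mset w"
  by (induction w rule: rev_induct)
    (simp_all add: P_tableau_snoc mset_concat_tableau_insert is_tableau_P, simp add: P_tableau_def)

text \<open>Entries at most \<open>u\<close> in a row are those equal to \<open>u\<close> and those
  less than \<open>u\<close>; strict columns bound the latter from below by the entries at most
  \<open>u\<close> of the next row. Chaining these bounds upwards from the bottom row, the total is
  tight iff each of them is.\<close>

lemma count_le_row_1:
  assumes "is_tableau T"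
  shows "count (mset (concat T)) u \<le> count_le u (mset (tableau_row T (Suc 0))) \<and>
    (count_le u (mset (tableau_row T (Suc 0))) = count (mset (concat T)) u \<longleftrightarrow>
      (\<forall>i. count_less u (mset (tableau_row T (Suc i))) =
           count_le u (mset (tableau_row T (Suc (Suc i))))))"
  using assms
proof (induction T)
  case Nil
  then show ?case by simp
next
  case (Cons R T)
  have split_0: "(\<forall>i. Q i) \<longleftrightarrow> Q 0 \<and> (\<forall>i. Q (Suc i))" for Q :: "nat \<Rightarrow> bool"
    by (metis not0_implies_Suc)
  have "count_le u (mset (tableau_row T (Suc 0))) \<le> count_less u (mset R)"
    using Cons.prems by (simp add: strictly_above_def)
  moreover have "(\<forall>i. count_less u (mset (tableau_row (R # T) (Suc i))) =
        count_le u (mset (tableau_row (R # T) (Suc (Suc i))))) \<longleftrightarrow>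
      count_less u (mset R) = count_le u (mset (tableau_row T (Suc 0))) \<and>
      (\<forall>i. count_less u (mset (tableau_row T (Suc i))) =
        count_le u (mset (tableau_row T (Suc (Suc i)))))"
    by (subst split_0) simp
  ultimately show ?case
    using Cons count_le_eq[of u "mset R"] by auto
qed

section \<open>Evolution of the surplus entry\<close>

text \<open>
  Below, \<open>A\<close> and \<open>B\<close> are the first rows of \<open>P(w)\<close> and \<open>P(uw)\<close>, and \<open>c\<close> is the number of letters
  \<open>u\<close> in \<open>w\<close>.
\<close>
definition surplus_kept :: "nat \<Rightarrow> nat list \<Rightarrow> nat list \<Rightarrow> nat \<Rightarrow> bool" where
  "surplus_kept u A B c \<longleftrightarrow> mset B = add_mset u (mset A) \<and> count_le u (mset A) = c"

text \<open>Either the surplus has left the first row, or it has grown to \<open>e\<close>. Lower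
  rows need no tracking any more, since the first rows will decide. The strict inequality is what
  makes (b) fail.\<close>

definition surplus_changed :: "nat \<Rightarrow> nat list \<Rightarrow> nat list \<Rightarrow> nat \<Rightarrow> bool" where
  "surplus_changed u A B c \<longleftrightarrow>
     (mset B = mset A \<or> (\<exists>e>u. mset B = add_mset e (mset A))) \<and> c < count_le u (mset A)"

text \<open>The two insertions act differently only if \<open>x < u\<close> and \<open>A\<close> has
  no entry above \<open>x\<close> and at most \<open>u\<close>. Then \<open>B\<close> bumps its
  surplus \<open>u\<close>, and \<open>x\<close> raises the count in \<open>A\<close> without being
  a letter \<open>u\<close>. Otherwise the bumped letters agree, and the count grows exactly when
  \<open>x = u\<close>.\<close>

lemma surplus_kept_step:
  fixes u x :: nat and A B :: "nat list" and c :: nat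
  assumes "sorted A" "sorted B" "surplus_kept u A B c"
  defines "A' \<equiv> fst (row_insert x A)" and "B' \<equiv> fst (row_insert x B)"
    and "c' \<equiv> c + (if x = u then 1 else 0)"
  shows "surplus_kept u A' B' c' \<and> snd (row_insert x A) = snd (row_insert x B) \<or>
    surplus_changed u A' B' c'"
proof -
  have B: "mset B = add_mset u (mset A)" and c: "count_le u (mset A) = c"
    using assms(3) by (auto simp: surplus_kept_def)
  have setB: "set B = insert u (set A)"
    using B by (metis set_mset_mset set_mset_add_mset_insert)
  from assms(1) show ?thesis
  proof (cases rule: row_insert_cases[of A x])
    case A: append
    from assms(2) show ?thesis
    proof (cases rule: row_insert_cases[of B x])
      case append
      then show ?thesis
        using A B c setB by (auto simp: surplus_kept_def A'_def B'_def c'_def)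
    next
      case (bump R z M)
      have "z \<in> set B" using bump(4) by (metis set_mset_mset union_single_eq_member)
      \<comment> \<open>Here \<open>A\<close> only grows by \<open>x\<close>, while \<open>B\<close>
        trades its surplus for \<open>x\<close>: the rows become equal as multisets.\<close>
      then have "z = u" using setB A(2) bump(3) by auto
      then show ?thesis
        using A bump B c by (auto simp: surplus_changed_def A'_def B'_def c'_def)
    qed
  next
    case A: (bump R y M)
    have y: "y \<in> set A" using A(4) by (metis set_mset_mset union_single_eq_member)
    from assms(2) show ?thesis
    proof (cases rule: row_insert_cases[of B x])
      case append
      then show ?thesis using y setB A(3) by auto
    next
      case B': (bump S z N)
      have z: "z \<in> set B" using B'(4) by (metis set_mset_mset union_single_eq_member)
      show ?thesis
      proof (cases "x < u \<and> u < y")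
        \<comment> \<open>\<open>B\<close> loses \<open>u\<close> and \<open>A\<close> loses
          \<open>y\<close>, so \<open>y > u\<close> is the new surplus.\<close>
        case True
        have "z \<le> u" using B'(6) setB True by simp
        moreover have "u \<le> z"
        proof (cases "z = u")
          case False
          then have "y \<le> z" using z setB A(6) B'(3) by simp
          then show ?thesis using True by simp
        qed simp
        ultimately have "z = u" by simp
        then have "N = mset A" using B'(4) B by simp
        then have "mset B' = add_mset y (mset A')"
          using A(1,4,5) B'(1,5) by (simp add: A'_def B'_def)
        moreover have "c' < count_le u (mset A')"
          using True A(1,4,5) c by (simp add: A'_def c'_def)
        ultimately show ?thesis
          using True by (auto simp: surplus_changed_def)
      next
        case False
        have "z \<le> y" using y setB A(3) B'(6) by simp
        moreover have "y \<le> z"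
        proof (cases "z = u")
          case True
          then show ?thesis using False B'(3) by simp
        next
          case False
          then show ?thesis using z setB A(6) B'(3) by simp
        qed
        ultimately have "z = y" by simp
        then have "N = add_mset u M" using B'(4) A(4) B by (simp add: add_mset_commute[of u])
        then have "mset B' = add_mset u (mset A')"
          using A(1,5) B'(1,5) by (simp add: A'_def B'_def)
        moreover have "c' = count_le u (mset A')"
          using False \<open>x < y\<close> A(1,4,5) c by (auto simp: A'_def c'_def)
        moreover have "snd (row_insert x A) = snd (row_insert x B)"
          using A(1) B'(1) \<open>z = y\<close> by simp
        ultimately show ?thesis
          by (simp add: surplus_kept_def)
      qed
    qed
  qed
qed

lemma count_le_row_insert:
  assumes "sorted A"
  shows "count_le u (mset A) + (if x = u then 1 else 0) \<le> count_le u (mset (fst (row_insert x A)))"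
  using assms by (cases rule: row_insert_cases[of A x]) auto

text \<open>A change is irreversible: a letter \<open>u\<close> raises \<open>c\<close> by one and
  the count by at least one, and no other letter lowers the count, so the gap never closes.\<close>

lemma surplus_changed_step:
  fixes u x :: nat and A B :: "nat list" and c :: nat
  assumes "sorted A" "sorted B" "surplus_changed u A B c"
  defines "A' \<equiv> fst (row_insert x A)" and "B' \<equiv> fst (row_insert x B)"
    and "c' \<equiv> c + (if x = u then 1 else 0)"
  shows "surplus_changed u A' B' c'"
proof -
  have c': "c' < count_le u (mset A')"
    using assms(3) count_le_row_insert[OF assms(1), of u x]
    by (simp add: surplus_changed_def A'_def c'_def split: if_splits)
  have "mset B' = mset A' \<or> (\<exists>e>u. mset B' = add_mset e (mset A'))"
  proof (cases "mset B = mset A")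
    case True
    then have "B = A" using assms(1,2) by (metis properties_for_sort)
    then show ?thesis by (simp add: A'_def B'_def)
  next
    case False
    then obtain e where e: "u < e" and B: "mset B = add_mset e (mset A)"
      using assms(3) by (auto simp: surplus_changed_def)
    \<comment> \<open>The surplus entry \<open>e\<close> itself evolves as in \<open>surplus_kept_step\<close>, with \<open>e\<close> in place of \<open>u\<close>.\<close>
    have "surplus_kept e A B (count_le e (mset A))"
      using B by (simp add: surplus_kept_def)
    from surplus_kept_step[OF assms(1,2) this, of x] e show ?thesis
      by (auto simp: surplus_kept_def surplus_changed_def A'_def B'_def intro: less_trans)
  qed
  then show ?thesis using c' by (simp add: surplus_changed_def)
qed

text \<open>While the surplus stays \<open>u\<close>, both first rows pass the same letter, or none,
  to identical lower rows, so these remain identical.\<close>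

lemma P_tableau_surplus:
  fixes u w
  defines "S \<equiv> P_tableau w" and "T \<equiv> P_tableau (u # w)"
  shows "surplus_kept u (tableau_row S (Suc 0)) (tableau_row T (Suc 0)) (count (mset w) u)
      \<and> tl T = tl S \<or>
    surplus_changed u (tableau_row S (Suc 0)) (tableau_row T (Suc 0)) (count (mset w) u)"
  unfolding S_def T_def
proof (induction w rule: rev_induct)
  case Nil
  then show ?case by (simp add: P_tableau_def surplus_kept_def)
next
  case (snoc x w)
  let ?A = "tableau_row (P_tableau w) (Suc 0)" and ?B = "tableau_row (P_tableau (u # w)) (Suc 0)"
  have A: "sorted ?A" and B: "sorted ?B"
    by (simp_all add: is_tableau_sorted_row_1 is_tableau_P)
  have P: "P_tableau (u # w @ [x]) = tableau_insert x (P_tableau (u # w))"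
    using P_tableau_snoc[of "u # w" x] by simp
  have c: "count (mset (w @ [x])) u = count (mset w) u + (if x = u then 1 else 0)"
    by simp
  note rw = P P_tableau_snoc tableau_insert_row_1 tl_tableau_insert c
  from snoc show ?case
  proof
    assume *: "surplus_kept u ?A ?B (count (mset w) u) \<and> tl (P_tableau (u # w)) = tl (P_tableau w)"
    then show ?thesis
      using surplus_kept_step[OF A B conjunct1[OF *], of x] unfolding rw
      by (elim disjE conjE) (simp_all cong: option.case_cong)
  next
    assume *: "surplus_changed u ?A ?B (count (mset w) u)"
    show ?thesis
      using surplus_changed_step[OF A B *, of x] unfolding rw by (rule disjI2)
  qed
qed

section \<open>The criterion for commuting with a letter\<close>

lemma knuth_equiv_commute_letter_iff:
  fixes u :: nat and w :: "nat list"
  defines "R \<equiv> tableau_row (P_tableau w) (Suc 0)"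
  shows "[u] @ w \<equiv>\<^sub>K w @ [u] \<longleftrightarrow>
    (\<forall>x\<in>set R. x \<le> u) \<and> count_le u (mset R) = count (mset w) u"
proof -
  let ?T = "P_tableau (u # w)"
  have sorted: "sorted R" "sorted (tableau_row ?T (Suc 0))"
    by (simp_all add: R_def is_tableau_sorted_row_1 is_tableau_P)
  have row: "tableau_row (tableau_insert u (P_tableau w)) (Suc 0) = fst (row_insert u R)"
    by (simp add: R_def tableau_insert_row_1)
  have equiv: "[u] @ w \<equiv>\<^sub>K w @ [u] \<longleftrightarrow> ?T = tableau_insert u (P_tableau w)"
    by (simp add: knuth_equiv_def P_tableau_snoc)
  have ne: "?T \<noteq> []"
    by (cases w rule: rev_cases)
      (simp_all add: P_tableau_def)
  from P_tableau_surplus[of u w] show ?thesis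
  proof (elim disjE conjE)
    assume kept: "surplus_kept u (tableau_row (P_tableau w) (Suc 0)) (tableau_row ?T (Suc 0))
        (count (mset w) u)"
      and tl: "tl ?T = tl (P_tableau w)"
    have T: "mset (tableau_row ?T (Suc 0)) = add_mset u (mset R)"
      and c: "count_le u (mset R) = count (mset w) u"
      using kept by (simp_all add: surplus_kept_def R_def)
    from sorted(1) show ?thesis
    proof (cases rule: row_insert_cases[of R u])
      case append
      have "sorted (R @ [u])" "mset (R @ [u]) = mset (tableau_row ?T (Suc 0))"
        using append sorted T by (auto simp: sorted_append)
      then have "tableau_row ?T (Suc 0) = R @ [u]"
        using sorted(2) by (metis properties_for_sort)
      moreover have "tl (tableau_insert u (P_tableau w)) = tl (P_tableau w)"
        using append(1) by (simp add: tl_tableau_insert R_def)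
      ultimately have "?T = tableau_insert u (P_tableau w)"
        using ne tl append(1) row by (simp add: tableau_eqI)
      then show ?thesis using equiv append c by simp
    next
      case (bump R' y M)
      have "y \<in> set R" using bump(4) by (metis set_mset_mset union_single_eq_member)
      \<comment> \<open>Bumping preserves the length of \<open>R\<close>, whereas the first row of
        \<open>?T\<close> is longer by one.\<close>
      moreover have "?T \<noteq> tableau_insert u (P_tableau w)"
      proof
        assume "?T = tableau_insert u (P_tableau w)"
        then have "mset R' = add_mset u (mset R)" using T bump(1) row by simp
        then show False using bump(4,5) by simp
      qed
      ultimately show ?thesis using equiv bump(3) by (auto simp flip: not_less)
    qed
  next
    assume changed: "surplus_changed u (tableau_row (P_tableau w) (Suc 0))
        (tableau_row ?T (Suc 0)) (count (mset w) u)"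
    then have T: "mset (tableau_row ?T (Suc 0)) = mset R \<or>
        (\<exists>e>u. mset (tableau_row ?T (Suc 0)) = add_mset e (mset R))"
      and c: "count_le u (mset R) \<noteq> count (mset w) u"
      by (auto simp: surplus_changed_def R_def)
    \<comment> \<open>Inserting \<open>u\<close> yields \<open>R\<close> with an extra
      \<open>u\<close>, or \<open>R\<close> with some \<open>y > u\<close> traded for
      \<open>u\<close>. The first row of \<open>?T\<close> is neither: it is \<open>R\<close> itself
      or has an extra \<open>e > u\<close>, up to order.\<close>
    from sorted(1) have "mset (fst (row_insert u R)) \<noteq> mset (tableau_row ?T (Suc 0))"
    proof (cases rule: row_insert_cases[of R u])
      case append
      then show ?thesis using T by auto
    next
      case (bump R' y M)
      have "mset R' \<noteq> mset R" using bump(3-5) by simp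
      moreover have "size (mset R') = size (mset R)" unfolding bump(4,5) by simp
      then have "mset R' \<noteq> add_mset e (mset R)" for e by (metis n_not_Suc_n size_add_mset)
      ultimately show ?thesis using T bump(1) by (metis fst_conv)
    qed
    then have "?T \<noteq> tableau_insert u (P_tableau w)"
      using row by metis
    then show ?thesis using equiv c by simp
  qed
qed

theorem theorem3p1:
  fixes u :: nat and w :: "nat list"
  assumes "0 < u" and "\<forall>x\<in>set w. 0 < x"
  shows "[u] @ w \<equiv>\<^sub>K w @ [u] \<longleftrightarrow>
    (\<forall>x\<in>set (tableau_row (P_tableau w) 1). x \<le> u) \<and>
    (\<forall>i\<ge>1. size (row_part (tableau_row (P_tableau w) i) (\<lambda>x. x < u)) =
            size (row_part (tableau_row (P_tableau w) (i + 1)) (\<lambda>x. x \<le> u)))"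
proof -
  have shift: "(\<forall>i\<ge>1. Q i) \<longleftrightarrow> (\<forall>i. Q (Suc i))" for Q :: "nat \<Rightarrow> bool"
    by (auto dest: Suc_le_D)
  show ?thesis
    unfolding shift row_part_def knuth_equiv_commute_letter_iff
    using count_le_row_1[OF is_tableau_P[of w], of u] by (simp add: mset_P_tableau)
qed

end
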